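(* Every simple planar cubic (3-regular) graph $G$ other than $K_4$ satisfies $a(G)\leq 2$.
   Context: $a(G)$ is the algebraic connectivity: the second smallest eigenvalue of the Laplacian $L=D-A$, where $A$ is the adjacency matrix and $D$ the diagonal matrix of vertex degrees. *)

theory Defs
  imports
    "HOL-Analysis.Path_Connected"
    "Graph_Theory.Graph_Theory"
    "Jordan_Normal_Form.Char_Poly"
begin

text \<open>
  Finite simple graphs are the symmetric digraphs of locale \<open>graph\<close>: an undirected edge \<open>{u, v}\<close>
  is the pair of opposite arcs \<open>(u, v)\<close>, \<open>(v, u)\<close>, so the degree of a vertex is its out-degree.
\<close>

definition cubic :: "('a, 'b) pre_digraph \<Rightarrow> bool" where
  "cubic G \<longleftrightarrow> (\<forall>v \<in> verts G. out_degree G v = 3)"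

text \<open>
  A plane drawing sends the vertices to distinct points and every edge to a simple arc between its
  end points. Arcs contain no vertex other than their end points, and two different edges meet at
  most in common end points. The two orientations of an edge are drawn as the same curve.
\<close>

definition plane_drawing ::
  "('a, 'b) pre_digraph \<Rightarrow> ('a \<Rightarrow> complex) \<Rightarrow> ('a \<Rightarrow> 'a \<Rightarrow> real \<Rightarrow> complex) \<Rightarrow> bool" where
  "plane_drawing G p \<gamma> \<longleftrightarrow>
     inj_on p (verts G) \<and>
     (\<forall>u v. u \<rightarrow>\<^bsub>G\<^esub> v \<longrightarrow>
        arc (\<gamma> u v) \<and> pathstart (\<gamma> u v) = p u \<and> pathfinish (\<gamma> u v) = p v \<and>
        \<gamma> v u = reversepath (\<gamma> u v) \<and>
        path_image (\<gamma> u v) \<inter> p ` verts G = {p u, p v}) \<and>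
     (\<forall>u v u' v'. u \<rightarrow>\<^bsub>G\<^esub> v \<longrightarrow> u' \<rightarrow>\<^bsub>G\<^esub> v' \<longrightarrow> {u, v} \<noteq> {u', v'} \<longrightarrow>
        path_image (\<gamma> u v) \<inter> path_image (\<gamma> u' v') \<subseteq> p ` ({u, v} \<inter> {u', v'}))"

definition planar :: "('a, 'b) pre_digraph \<Rightarrow> bool" where
  "planar G \<longleftrightarrow> (\<exists>p \<gamma>. plane_drawing G p \<gamma>)"

text \<open>The matrices are taken with respect to an enumeration \<open>vs\<close> of the vertices.\<close>

definition adjacency_mat :: "('a, 'b) pre_digraph \<Rightarrow> 'a list \<Rightarrow> real mat" where
  "adjacency_mat G vs = Matrix.mat (length vs) (length vs)
     (\<lambda>(i, j). if vs ! i \<rightarrow>\<^bsub>G\<^esub> vs ! j then 1 else 0)"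

definition degree_mat :: "('a, 'b) pre_digraph \<Rightarrow> 'a list \<Rightarrow> real mat" where
  "degree_mat G vs = Matrix.mat (length vs) (length vs)
     (\<lambda>(i, j). if i = j then real (out_degree G (vs ! i)) else 0)"

definition laplacian_mat :: "('a, 'b) pre_digraph \<Rightarrow> 'a list \<Rightarrow> real mat" where
  "laplacian_mat G vs = degree_mat G vs - adjacency_mat G vs"

definition vertex_enum :: "('a, 'b) pre_digraph \<Rightarrow> 'a list" where
  "vertex_enum G = (SOME vs. distinct vs \<and> set vs = verts G)"

text \<open>
  The eigenvalues in increasing order, repeated according to multiplicity, as roots of the
  characteristic polynomial; by \<open>laplacian_eigenvalues_enum\<close> below they do not depend on the
  chosen enumeration.
\<close>

definition laplacian_eigenvalues :: "('a, 'b) pre_digraph \<Rightarrow> real list" where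
  "laplacian_eigenvalues G =
     sorted_list_of_multiset (proots (char_poly (laplacian_mat G (vertex_enum G))))"

text \<open>Second smallest eigenvalue; only meaningful for graphs with at least two vertices.\<close>

definition algebraic_connectivity :: "('a, 'b) pre_digraph \<Rightarrow> real" where
  "algebraic_connectivity G = laplacian_eigenvalues G ! 1"

lemma char_poly_laplacian_mat_enum:
  assumes "distinct vs" "distinct ws" "set vs = set ws"
  shows "char_poly (laplacian_mat G vs) = char_poly (laplacian_mat G ws)"
proof -
  define n where "n = length vs"
  have lw: "length ws = n"
    using assms distinct_card n_def by metis
  have "mset ws = mset vs"
    using assms set_eq_iff_mset_eq_distinct by blast
  then obtain f where f: "f permutes {..<length vs}" and fw: "permute_list f vs = ws"
    by (rule mset_eq_permutation)
  have f': "f permutes {0..<n}"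
    using f by (simp add: n_def lessThan_atLeast0)
  have fn: "f i < n" if "i < n" for i
    using permutes_in_image[OF f', of i] that by simp
  have nth: "ws ! i = vs ! f i" if "i < n" for i
    using permute_list_nth[OF f, of i] that fw by (simp add: n_def)
  have inj: "f i = f j \<longleftrightarrow> i = j" for i j
    using permutes_inj[OF f'] by (auto dest: injD)
  let ?A = "char_poly_matrix (laplacian_mat G vs)"
  let ?B = "Matrix.mat n n (\<lambda>(i, j). ?A $$ (f i, j))"
  let ?C = "Matrix.mat n n (\<lambda>(i, j). ?A $$ (f i, f j))"
  have cA: "?A \<in> carrier_mat n n"
    by (auto simp: char_poly_matrix_def laplacian_mat_def adjacency_mat_def degree_mat_def n_def)
  have C: "char_poly_matrix (laplacian_mat G ws) = ?C"
    by (rule eq_matI)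
      (auto simp: char_poly_matrix_def laplacian_mat_def adjacency_mat_def degree_mat_def
        n_def[symmetric] lw nth fn inj)
  have T: "transpose_mat ?C = Matrix.mat n n (\<lambda>(i, j). transpose_mat ?B $$ (f i, j))"
    by (rule eq_matI) (auto simp: fn)
  have "Determinant.det ?C = Determinant.det (transpose_mat ?C)"
    by (rule Determinant.det_transpose[symmetric]) auto
  also have "\<dots> = signof f * Determinant.det (transpose_mat ?B)"
    unfolding T by (rule Determinant.det_permute_rows[OF _ f']) auto
  also have "Determinant.det (transpose_mat ?B) = Determinant.det ?B"
    by (rule Determinant.det_transpose) auto
  also have "Determinant.det ?B = signof f * Determinant.det ?A"
    by (rule Determinant.det_permute_rows[OF cA f'])
  finally have "Determinant.det ?C = signof f * (signof f * Determinant.det ?A)" .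
  then have "Determinant.det ?C = Determinant.det ?A"
    by (simp add: sign_def)
  then show ?thesis
    by (simp add: char_poly_def C)
qed

lemma laplacian_eigenvalues_enum:
  assumes "distinct vs" "set vs = verts G"
  shows "laplacian_eigenvalues G = sorted_list_of_multiset (proots (char_poly (laplacian_mat G vs)))"
proof -
  have "distinct (vertex_enum G) \<and> set (vertex_enum G) = verts G"
    unfolding vertex_enum_def by (rule someI[of _ vs]) (use assms in simp)
  then show ?thesis
    unfolding laplacian_eigenvalues_def
    using char_poly_laplacian_mat_enum[of "vertex_enum G" vs G] assms by simp
qed

end

theory Submission
  imports
    Defs
    "Jordan_Normal_Form.Schur_Decomposition"
    "HOL-Analysis.Jordan_Curve"
begin

text \<open>
  If the second smallest Laplacian eigenvalue of a cubic graph on \<open>n\<close> vertices exceeds 2, then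
  \<open>y\<^sup>T A y < y\<^sup>T y\<close> for every nonzero \<open>y\<close> orthogonal to the constant vector. Suitable test vectors
  show \<open>n < 10\<close> (weight 2 on a vertex and 1 on its neighbours), that a triangle forces \<open>n < 6\<close> and that
  a quadrangle forces \<open>n < 8\<close>. Since \<open>n\<close> is even, and \<open>n = 8\<close> is impossible because without triangles
  and quadrangles 10 vertices lie within distance 2 of any vertex, only \<open>n = 4\<close>, which is the complete graph
  \<open>K\<^sub>4\<close>, and \<open>n = 6\<close> without triangles, which is \<open>K\<^sub>3\<^sub>,\<^sub>3\<close>, remain. The latter is not planar.
\<close>

section \<open>Symmetric real matrices\<close>

text \<open>The characteristic polynomial splits over the complex numbers. For a complex eigenvector
  \<open>v\<close> with eigenvalue \<open>z\<close>, the Hermitian form \<open>S\<close> is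
  \<open>z\<close> times the squared norm \<open>R > 0\<close>, and by symmetry it is its own
  conjugate. So \<open>z\<close> is real.\<close>

lemma symmetric_real_mat_has_eigenvalue:
  fixes A :: "real mat"
  assumes A: "A \<in> carrier_mat n n" and sym: "transpose_mat A = A" and n: "n > 0"
  shows "\<exists>e. eigenvalue A e"
proof -
  let ?C = "map_mat complex_of_real A"
  have C: "?C \<in> carrier_mat n n" using A by simp
  obtain as where as: "char_poly ?C = (\<Prod>a\<leftarrow>as. [:- a, 1:])" "length as = n"
    using char_poly_factorized[OF C] by blast
  obtain z zs where "as = z # zs" using as(2) n by (cases as) auto
  then have z: "poly (char_poly ?C) z = 0" using as(1) by simp
  then have "eigenvalue ?C z" using eigenvalue_root_char_poly[OF C] by blast
  then obtain v where v: "v \<in> carrier_vec n" "v \<noteq> 0\<^sub>v n" "?C *\<^sub>v v = z \<cdot>\<^sub>v v"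
    using C unfolding eigenvalue_def eigenvector_def by auto
  have sA: "A $$ (i, j) = A $$ (j, i)" if "i < n" "j < n" for i j
    using arg_cong[OF sym, of "\<lambda>M. M $$ (i, j)"] that A by simp
  have row: "(\<Sum>j<n. of_real (A $$ (i, j)) * v $ j) = z * v $ i" if "i < n" for i
    using arg_cong[OF v(3), of "\<lambda>w. w $ i"] that A v(1)
    by (simp add: scalar_prod_def lessThan_atLeast0)
  define S where "S = (\<Sum>i<n. \<Sum>j<n. cnj (v $ i) * (of_real (A $$ (i, j)) * v $ j))"
  define R where "R = (\<Sum>i<n. (cmod (v $ i))\<^sup>2)"
  have "S = (\<Sum>i<n. cnj (v $ i) * (z * v $ i))"
    unfolding S_def by (rule sum.cong) (auto simp: row sum_distrib_left[symmetric])
  also have "\<dots> = z * of_real R"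
    unfolding R_def of_real_sum sum_distrib_left
    by (rule sum.cong) (auto simp: complex_norm_square[symmetric] mult_ac simp del: of_real_power)
  finally have S: "S = z * of_real R" .
  have "cnj S = (\<Sum>i<n. \<Sum>j<n. v $ i * (of_real (A $$ (i, j)) * cnj (v $ j)))"
    unfolding S_def by simp
  also have "\<dots> = (\<Sum>j<n. \<Sum>i<n. v $ i * (of_real (A $$ (i, j)) * cnj (v $ j)))"
    by (rule sum.swap)
  also have "\<dots> = S"
    unfolding S_def by (intro sum.cong refl) (auto simp: sA)
  finally have real_S: "cnj S = S" .
  obtain k where k: "k < n" "v $ k \<noteq> 0" using v(1,2) by (metis eq_vecI carrier_vecD index_zero_vec)
  have "R > 0"
    unfolding R_def by (rule sum_pos2[of _ k]) (use k in auto)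
  then have "cnj z = z" using real_S S by simp
  then have zr: "z = of_real (Re z)"
    by (metis Reals_cnj_iff of_real_Re)
  have "poly (char_poly ?C) (of_real (Re z)) = of_real (poly (char_poly A) (Re z))"
    by (simp add: of_real_hom.char_poly_hom[OF A])
  then have "poly (char_poly A) (Re z) = 0"
    using z zr by (metis of_real_eq_0_iff)
  then show ?thesis using eigenvalue_root_char_poly[OF A] by blast
qed

text \<open>Lets an orthogonal change of basis start at a given eigenvector: Gram-Schmidt keeps the
  first vector of a basis, and normalising only rescales it, whence the factor
  \<open>c\<close>.\<close>

lemma orthogonal_mat_with_first_column:
  fixes v :: "real vec"
  assumes v: "v \<in> carrier_vec n" and v0: "v \<noteq> 0\<^sub>v n"
  obtains W c where "W \<in> carrier_mat n n" "transpose_mat W * W = 1\<^sub>m n" "col W 0 = c \<cdot>\<^sub>v v"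
proof -
  interpret cof_vec_space n "TYPE(real)" .
  define b where "b = basis_completion v"
  define ws where "ws = gram_schmidt n b"
  have b: "distinct b" "\<not> lin_dep (set b)" "set b \<subseteq> carrier_vec n" "hd b = v" "length b = n"
    using basis_completion[OF v v0] unfolding b_def by auto
  have n: "n > 0" using v v0 by (cases n) auto
  then obtain vs where bv: "b = v # vs" using b by (cases b) auto
  have ws: "set ws \<subseteq> carrier_vec n" "corthogonal ws" "length ws = n"
    using gram_schmidt_result[OF b(3,1,2) refl] b(5) unfolding ws_def by auto
  have hd: "ws ! 0 = v"
    using gram_schmidt_hd[OF v, of vs] ws(3) n unfolding ws_def bv by (metis hd_conv_nth length_greater_0_conv)
  have wsc: "ws ! i \<in> carrier_vec n" if "i < n" for i
    using ws that by (metis nth_mem subsetD)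
  \<comment> \<open>The case \<open>i = j\<close> says that no vector has length 0, so each may be
    divided by its norm.\<close>
  have prod: "ws ! i \<bullet> ws ! j = 0 \<longleftrightarrow> i \<noteq> j" if "i < n" "j < n" for i j
    using corthogonalD[OF ws(2), of i j] ws(3) that by simp
  have pos: "ws ! i \<bullet> ws ! i > 0" if "i < n" for i
    using prod[OF that that] by (simp add: scalar_prod_def order_less_le sum_nonneg)
  define u where "u i = (1 / sqrt (ws ! i \<bullet> ws ! i)) \<cdot>\<^sub>v ws ! i" for i
  define W where "W = mat_of_cols n (map u [0..<n])"
  have uc: "u i \<in> carrier_vec n" if "i < n" for i
    unfolding u_def using wsc[OF that] by simp
  have W: "W \<in> carrier_mat n n" unfolding W_def using mat_of_cols_carrier(1)[of n "map u [0..<n]"] by simp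
  have cW: "col W i = u i" if "i < n" for i
    unfolding W_def using that uc by (subst col_mat_of_cols) auto
  have "transpose_mat W * W = 1\<^sub>m n"
  proof (rule eq_matI)
    fix i j assume ij: "i < dim_row (1\<^sub>m n :: real mat)" "j < dim_col (1\<^sub>m n :: real mat)"
    then have "(transpose_mat W * W) $$ (i, j) = u i \<bullet> u j"
      using W cW by simp
    also have "\<dots> = (ws ! i \<bullet> ws ! j) / (sqrt (ws ! i \<bullet> ws ! i) * sqrt (ws ! j \<bullet> ws ! j))"
      using ij wsc[of i] wsc[of j] by (simp add: u_def)
    also have "\<dots> = 1\<^sub>m n $$ (i, j)"
      using ij prod[of i j] pos[of i] by auto
    finally show "(transpose_mat W * W) $$ (i, j) = 1\<^sub>m n $$ (i, j)" .
  qed (use W in auto)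
  moreover have "col W 0 = (1 / sqrt (v \<bullet> v)) \<cdot>\<^sub>v v"
    using cW[OF n] hd by (simp add: u_def)
  ultimately show ?thesis using that W by blast
qed

text \<open>Spectral theorem by deflation: in an orthonormal basis whose first vector is an
  eigenvector, the matrix splits into a 1 by 1 block and a smaller symmetric block, to which the
  induction hypothesis applies.\<close>

lemma symmetric_real_mat_orthogonally_diagonalizable:
  fixes A :: "real mat"
  assumes "A \<in> carrier_mat n n" and "transpose_mat A = A"
  shows "\<exists>P d. P \<in> carrier_mat n n \<and> transpose_mat P * P = 1\<^sub>m n \<and>
    transpose_mat P * A * P = Matrix.mat n n (\<lambda>(i, j). if i = j then d i else 0)"
  using assms
proof (induction n arbitrary: A)
  case 0
  then show ?case by (intro exI[of _ "1\<^sub>m 0"]) (auto intro!: eq_matI)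
next
  case (Suc n A)
  note A = Suc.prems(1) and sym = Suc.prems(2)
  obtain e v where v: "v \<in> carrier_vec (Suc n)" "v \<noteq> 0\<^sub>v (Suc n)" "A *\<^sub>v v = e \<cdot>\<^sub>v v"
    using symmetric_real_mat_has_eigenvalue[OF A sym] A unfolding eigenvalue_def eigenvector_def by auto
  obtain W c where W: "W \<in> carrier_mat (Suc n) (Suc n)" and WW: "transpose_mat W * W = 1\<^sub>m (Suc n)"
    and c: "col W 0 = c \<cdot>\<^sub>v v"
    using orthogonal_mat_with_first_column[OF v(1,2)] by blast
  define M where "M = transpose_mat W * A * W"
  define N where "N = Matrix.mat n n (\<lambda>(i, j). M $$ (Suc i, Suc j))"
  have M: "M \<in> carrier_mat (Suc n) (Suc n)" using W A by (simp add: M_def)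
  have symM: "transpose_mat M = M"
    unfolding M_def using W A sym
    by (subst transpose_mult[of _ "Suc n" "Suc n" _ "Suc n"], simp, simp,
        subst transpose_mult[of _ "Suc n" "Suc n" _ "Suc n"])
       (auto simp: assoc_mult_mat[of _ "Suc n" "Suc n" _ "Suc n" _ "Suc n"])
  have sM: "M $$ (i, j) = M $$ (j, i)" if "i < Suc n" "j < Suc n" for i j
    using arg_cong[OF symM, of "\<lambda>X. X $$ (i, j)"] that M by simp
  \<comment> \<open>The first column of \<open>W\<close> is an eigenvector or a multiple of one, so
    orthonormality makes the first column of \<open>M\<close> equal to \<open>e\<close> times the
    first unit vector.\<close>
  have M0: "M $$ (i, 0) = (if i = 0 then e else 0)" if i: "i < Suc n" for i
  proof -
    have "M = transpose_mat W * (A * W)"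
      unfolding M_def using W A by (intro assoc_mult_mat) auto
    then have "M $$ (i, 0) = row (transpose_mat W) i \<bullet> col (A * W) 0"
      using W A i by simp
    also have "row (transpose_mat W) i = col W i" using W i by simp
    also have "col (A * W) 0 = A *\<^sub>v col W 0"
      using W A by (intro eq_vecI) auto
    also have "\<dots> = e \<cdot>\<^sub>v col W 0"
      unfolding c using A v by (simp add: mult_mat_vec[of _ _ "Suc n"] smult_smult_assoc mult.commute)
    also have "col W i \<bullet> (e \<cdot>\<^sub>v col W 0) = e * (transpose_mat W * W) $$ (i, 0)"
      using W i by simp
    also have "\<dots> = (if i = 0 then e else 0)"
      unfolding WW using i by simp
    finally show ?thesis .
  qed
  have N: "N \<in> carrier_mat n n" by (simp add: N_def)
  have symN: "transpose_mat N = N"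
    by (rule eq_matI) (auto simp: N_def sM)
  obtain P d where P: "P \<in> carrier_mat n n" and PP: "transpose_mat P * P = 1\<^sub>m n"
    and D: "transpose_mat P * N * P = Matrix.mat n n (\<lambda>(i, j). if i = j then d i else 0)"
    using Suc.IH[OF N symN] by blast
  let ?E = "Matrix.mat 1 1 (\<lambda>_. e)"
  let ?Q = "four_block_mat (1\<^sub>m 1) (0\<^sub>m 1 n) (0\<^sub>m n 1) P"
  let ?Z = "0\<^sub>m 1 n :: real mat" and ?Z' = "0\<^sub>m n 1 :: real mat"
  \<comment> \<open>Symmetry clears the first row too. Conjugation with \<open>?Q\<close>, which has
    the diagonal blocks 1 and \<open>P\<close>, then diagonalises \<open>N\<close> and leaves
    \<open>e\<close> alone.\<close>
  have MB: "M = four_block_mat ?E ?Z ?Z' N"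
  proof (rule eq_matI)
    fix i j assume ij: "i < dim_row (four_block_mat ?E ?Z ?Z' N)" "j < dim_col (four_block_mat ?E ?Z ?Z' N)"
    then have "i < Suc n" "j < Suc n" using N by auto
    then show "M $$ (i, j) = four_block_mat ?E ?Z ?Z' N $$ (i, j)"
      using M0[of i] M0[of j] sM[of i j] N by (cases i; cases j) (auto simp: N_def)
  qed (use M N in auto)
  have Q: "?Q \<in> carrier_mat (Suc n) (Suc n)" using P by auto
  have QT: "transpose_mat ?Q = four_block_mat (1\<^sub>m 1) ?Z ?Z' (transpose_mat P)"
    using P by (subst transpose_four_block_mat) auto
  have QQ: "transpose_mat ?Q * ?Q = 1\<^sub>m (Suc n)"
    unfolding QT using P
    by (subst mult_four_block_mat[of _ 1 1 _ n _ n _ _ 1 _ n])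
       (auto simp: PP simp flip: one_mat_def[of "Suc n"] intro!: eq_matI)
  have QMQ: "transpose_mat ?Q * M * ?Q = four_block_mat ?E ?Z ?Z' (transpose_mat P * N * P)"
    unfolding QT MB using P N
    by (subst mult_four_block_mat[of _ 1 1 _ n _ n _ _ 1 _ n], auto)
       (subst mult_four_block_mat[of _ 1 1 _ n _ n _ _ 1 _ n], auto)
  let ?R = "W * ?Q"
  have WQ: "transpose_mat ?R = transpose_mat ?Q * transpose_mat W"
    using W Q by (intro transpose_mult) auto
  have "transpose_mat ?R * ?R = transpose_mat ?Q * (transpose_mat W * W) * ?Q"
    unfolding WQ using W Q by (simp add: assoc_mult_mat[of _ "Suc n" "Suc n" _ "Suc n" _ "Suc n"])
  then have 1: "transpose_mat ?R * ?R = 1\<^sub>m (Suc n)"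
    unfolding WW using Q QQ right_mult_one_mat[of "transpose_mat ?Q" "Suc n" "Suc n"] by simp
  have "transpose_mat ?R * A * ?R = transpose_mat ?Q * M * ?Q"
    unfolding WQ M_def using W Q A by (simp add: assoc_mult_mat[of _ "Suc n" "Suc n" _ "Suc n" _ "Suc n"])
  also have "\<dots> = Matrix.mat (Suc n) (Suc n) (\<lambda>(i, j). if i = j then (case i of 0 \<Rightarrow> e | Suc k \<Rightarrow> d k) else 0)"
    unfolding QMQ D by (rule eq_matI) (auto split: nat.split)
  finally show ?case using 1 W Q by (meson mult_carrier_mat)
qed

text \<open>In an orthonormal eigenbasis at most one coordinate \<open>k\<close> has an eigenvalue
  below \<open>c\<close>. Since \<open>\<mu> < c\<close>, the vector \<open>u\<close> lives on that
  coordinate only; orthogonality to \<open>u\<close> removes it from \<open>x\<close>, and every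
  other coordinate contributes at least \<open>c\<close> times its square.\<close>

lemma rayleigh_second_smallest_eigenvalue:
  fixes A :: "real mat" and u x :: "real vec"
  assumes A: "A \<in> carrier_mat n n" and sym: "transpose_mat A = A" and n: "n \<ge> 2"
    and c: "c = sorted_list_of_multiset (proots (char_poly A)) ! 1"
    and u: "u \<in> carrier_vec n" "u \<noteq> 0\<^sub>v n" "A *\<^sub>v u = \<mu> \<cdot>\<^sub>v u" "\<mu> < c"
    and x: "x \<in> carrier_vec n" "x \<bullet> u = 0"
  shows "c * (x \<bullet> x) \<le> x \<bullet> (A *\<^sub>v x)"
proof -
  obtain P d where P: "P \<in> carrier_mat n n" and PP: "transpose_mat P * P = 1\<^sub>m n"
    and D: "transpose_mat P * A * P = Matrix.mat n n (\<lambda>(i, j). if i = j then d i else 0)"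
    using symmetric_real_mat_orthogonally_diagonalizable[OF A sym] by blast
  let ?P = "transpose_mat P"
  define B where "B = Matrix.mat n n (\<lambda>(i, j). if i = j then d i else (0::real))"
  have B: "B \<in> carrier_mat n n" by (simp add: B_def)
  have PT: "?P \<in> carrier_mat n n" using P by simp
  have PP': "P * ?P = 1\<^sub>m n" using mat_mult_left_right_inverse[OF PT P PP] .
  have "P * (?P * A * P) * ?P = (P * ?P) * A * (P * ?P)"
    using P PT A by (simp add: assoc_mult_mat[of _ n n _ n _ n])
  then have AB: "A = P * B * ?P"
    using D A unfolding B_def[symmetric] PP' by simp
  have "similar_mat A B"
    unfolding similar_mat_def using similar_mat_witI[OF PP' PP AB A B P PT] by blast
  then have "char_poly A = char_poly B" by (rule char_poly_similar)
  also have "\<dots> = (\<Prod>a\<leftarrow>diag_mat B. [:- a, 1:])"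
    by (rule char_poly_upper_triangular[OF B]) (auto simp: B_def)
  also have "diag_mat B = map d [0..<n]"
    by (auto simp: diag_mat_def B_def intro!: nth_equalityI)
  finally have cp: "char_poly A = (\<Prod>a\<leftarrow>map d [0..<n]. [:- a, 1:])" .
  have roots: "proots (\<Prod>a\<leftarrow>as. [:- a, 1:]) = mset as" for as :: "real list"
  proof (induction as)
    case (Cons a as)
    have "(\<Prod>a\<leftarrow>as. [:- a, 1:]) \<noteq> 0" by (auto simp: prod_list_zero_iff)
    then show ?case using Cons by (simp add: proots_mult del: mult_pCons_left)
  qed simp
  define l where "l = sorted_list_of_multiset (proots (char_poly A))"
  have l: "sorted l" "mset l = mset (map d [0..<n])"
    unfolding l_def cp roots by (simp_all only: sorted_sorted_list_of_multiset mset_sorted_list_of_multiset)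
  have "length l = n" using arg_cong[OF l(2), of size] by simp
  then obtain a b l' where ll: "l = a # b # l'" using n by (cases l; cases "tl l") auto
  have cb: "c = b" using c ll by (simp add: l_def[symmetric])
  \<comment> \<open>As \<open>c\<close> sits at index 1 of the sorted list, only the entry at index
    0 can be smaller. Equality of multisets transfers this count, with multiplicity, to the diagonal
    entries \<open>d\<close>.\<close>
  have "filter (\<lambda>t. t < c) (b # l') = []"
    using l(1) unfolding ll cb by (auto simp: filter_empty_conv)
  then have "length (filter (\<lambda>t. t < c) l) \<le> 1" unfolding ll by simp
  also have "length (filter (\<lambda>t. t < c) l) = size (filter_mset (\<lambda>t. t < c) (mset l))"
    by (simp flip: mset_filter)
  also have "\<dots> = length (filter (\<lambda>t. t < c) (map d [0..<n]))"
    unfolding l(2) by (simp only: mset_filter[symmetric] size_mset)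
  also have "\<dots> = card {i. i < n \<and> d i < c}"
    by (subst length_filter_conv_card) (auto intro: arg_cong[of _ _ card])
  finally have small: "card {i. i < n \<and> d i < c} \<le> 1" .
  have Bv: "(B *\<^sub>v v) $ i = d i * v $ i" if "v \<in> carrier_vec n" "i < n" for v i
  proof -
    have "(B *\<^sub>v v) $ i = (\<Sum>j\<in>{0..<n}. (if i = j then d i else 0) * v $ j)"
      using that by (simp add: B_def scalar_prod_def)
    also have "\<dots> = (\<Sum>j\<in>{0..<n}. if i = j then d i * v $ j else 0)"
      by (intro sum.cong) auto
    also have "\<dots> = d i * v $ i" using that by simp
    finally show ?thesis .
  qed
  have APv: "?P *\<^sub>v (A *\<^sub>v v) = B *\<^sub>v (?P *\<^sub>v v)" if v: "v \<in> carrier_vec n" for v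
  proof -
    have "?P * A = ?P * P * (B * ?P)"
      unfolding AB using P PT B by (simp add: assoc_mult_mat[of _ n n _ n _ n])
    then have "?P * A = B * ?P" using PP B PT by simp
    then show ?thesis using A B P PT v by (metis assoc_mult_mat_vec)
  qed
  have iso: "(?P *\<^sub>v v) \<bullet> (?P *\<^sub>v w) = v \<bullet> w" if v: "v \<in> carrier_vec n" and w: "w \<in> carrier_vec n" for v w
  proof -
    have "(?P *\<^sub>v v) \<bullet> (?P *\<^sub>v w) = v \<bullet> (P *\<^sub>v (?P *\<^sub>v w))"
      using P PT v w by (intro transpose_vec_mult_scalar) auto
    also have "P *\<^sub>v (?P *\<^sub>v w) = w"
      using P PT w PP' by (simp flip: assoc_mult_mat_vec[of _ n n _ n])
    finally show ?thesis .
  qed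
  define w where "w = ?P *\<^sub>v u"
  define z where "z = ?P *\<^sub>v x"
  have w: "w \<in> carrier_vec n" and z: "z \<in> carrier_vec n" using PT u(1) x(1) by (auto simp: w_def z_def)
  have "B *\<^sub>v w = \<mu> \<cdot>\<^sub>v w"
    unfolding w_def using APv[OF u(1)] u PT by (simp add: mult_mat_vec[OF PT u(1)])
  then have wd: "d i = \<mu>" if "i < n" "w $ i \<noteq> 0" for i
    using Bv[OF w that(1)] that w by simp
  have "w \<noteq> 0\<^sub>v n"
  proof
    assume "w = 0\<^sub>v n"
    then have "u \<bullet> u = 0" using iso[OF u(1) u(1)] w by (simp add: w_def[symmetric])
    then show False using u conjugate_square_eq_0_vec[OF u(1)] by simp
  qed
  then obtain k where k: "k < n" "w $ k \<noteq> 0" using w by (metis eq_vecI carrier_vecD index_zero_vec)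
  \<comment> \<open>The index \<open>k\<close> from the support of \<open>w\<close> has
    \<open>d k = \<mu>\<close> and so uses up the only place below \<open>c\<close>.\<close>
  have big: "d i \<ge> c" if "i < n" "i \<noteq> k" for i
  proof (rule ccontr)
    assume "\<not> d i \<ge> c"
    then have "{i, k} \<subseteq> {i. i < n \<and> d i < c}" using k wd[OF k] u(4) that by auto
    then have "card {i, k} \<le> 1" using small card_mono[of "{i. i < n \<and> d i < c}" "{i, k}"] by auto
    then show False using that by simp
  qed
  have "w $ i = 0" if "i < n" "i \<noteq> k" for i
    using wd[of i] big[OF that] u(4) that by fastforce
  then have "z \<bullet> w = (\<Sum>i\<in>{0..<n}. if i = k then z $ k * w $ k else 0)"
    unfolding scalar_prod_def using w by (intro sum.cong) auto
  then have "z \<bullet> w = z $ k * w $ k" using k by simp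
  moreover have "z \<bullet> w = 0" using iso[OF x(1) u(1)] x(2) by (simp add: z_def w_def)
  ultimately have zk: "z $ k = 0" using k by simp
  have "c * (x \<bullet> x) = c * (z \<bullet> z)" using iso[OF x(1) x(1)] by (simp add: z_def)
  also have "\<dots> = (\<Sum>i\<in>{0..<n}. c * (z $ i)\<^sup>2)"
    using z by (simp add: scalar_prod_def sum_distrib_left power2_eq_square)
  also have "\<dots> \<le> (\<Sum>i\<in>{0..<n}. d i * (z $ i)\<^sup>2)"
  proof (rule sum_mono)
    fix i assume "i \<in> {0..<n}"
    then show "c * (z $ i)\<^sup>2 \<le> d i * (z $ i)\<^sup>2"
      using big[of i] zk by (cases "i = k") (auto intro: mult_right_mono)
  qed
  also have "\<dots> = z \<bullet> (B *\<^sub>v z)"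
    using B z Bv[OF z] by (auto simp: scalar_prod_def power2_eq_square mult_ac intro!: sum.cong simp del: index_mult_mat_vec)
  also have "\<dots> = x \<bullet> (A *\<^sub>v x)"
    unfolding z_def APv[OF x(1), symmetric] using A x by (intro iso) auto
  finally show ?thesis .
qed

section \<open>Cubic graphs with a large spectral gap\<close>

lemma even_card_involution:
  assumes "finite A" "\<And>x. x \<in> A \<Longrightarrow> f x \<in> A" "\<And>x. x \<in> A \<Longrightarrow> f (f x) = x" "\<And>x. x \<in> A \<Longrightarrow> f x \<noteq> x"
  shows "even (card A)"
  using assms
proof (induction A rule: finite_psubset_induct)
  case (psubset A)
  show ?case
  proof (cases "A = {}")
    case False
    then obtain x where x: "x \<in> A" by blast
    let ?B = "A - {x, f x}"
    have B: "?B \<subset> A" using x by blast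
    have "even (card ?B)"
      using psubset.IH[OF B] psubset.prems x by (metis Diff_iff insert_iff singletonD)
    moreover have "card A = card ?B + 2"
      using psubset.hyps psubset.prems(1,3)[OF x] x card_mono[of A "{x, f x}"]
      by (subst card_Diff_subset) auto
    ultimately show ?thesis by simp
  qed simp
qed

text \<open>The Laplacian form of a cubic graph is \<open>3 * y\<^sup>2\<close> minus the adjacency
  form, summed over the vertices. That it exceeds twice the squared norm on nonzero vectors with sum
  0 is exactly \<open>gap\<close>; \<open>u\<close> witnesses that \<open>y\<close> is nonzero on
  \<open>V\<close>.\<close>

locale cubic_relation_with_gap =
  fixes V :: "'a set" and E :: "'a \<Rightarrow> 'a \<Rightarrow> bool"
  assumes fin: "finite V" and nonempty: "V \<noteq> {}"
    and E_in: "E v w \<Longrightarrow> v \<in> V" and E_sym: "E v w \<Longrightarrow> E w v" and E_irrefl: "\<not> E v v"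
    and E_deg: "v \<in> V \<Longrightarrow> card {w. E v w} = 3"
    and gap: "(\<Sum>v\<in>V. y v) = 0 \<Longrightarrow> u \<in> V \<Longrightarrow> y u \<noteq> (0::real) \<Longrightarrow>
      (\<Sum>v\<in>V. y v * (\<Sum>w | E v w. y w)) < (\<Sum>v\<in>V. (y v)\<^sup>2)"
begin

section \<open>Neighbourhoods, parity and double counting\<close>

definition N :: "'a \<Rightarrow> 'a set" where "N v = {w. E v w}"

lemma N_subset: "N v \<subseteq> V" and N_sym: "w \<in> N v \<longleftrightarrow> v \<in> N w" and N_irrefl: "v \<notin> N v"
  using E_in E_sym E_irrefl by (auto simp: N_def)

lemma finite_N [simp]: "finite (N v)"
  using N_subset fin finite_subset by blast

lemma card_N: "v \<in> V \<Longrightarrow> card (N v) = 3"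
  using E_deg by (simp add: N_def)

text \<open>Handshake argument: reversal is an involution without fixed points on the
  \<open>3 * card V\<close> ordered pairs of adjacent vertices.\<close>

lemma even_card_V: "even (card V)"
proof -
  have "even (card (SIGMA v:V. N v))"
  proof (rule even_card_involution[of _ prod.swap])
    fix x assume "x \<in> (SIGMA v:V. N v)"
    then obtain v w where x: "x = (v, w)" and w: "w \<in> N v" by blast
    then have "v \<in> N w" using N_sym by metis
    then show "prod.swap x \<in> (SIGMA v:V. N v)" "prod.swap x \<noteq> x"
      using x w N_subset N_irrefl by auto
  qed (use fin in auto)
  also have "card (SIGMA v:V. N v) = card V * 3"
    using fin card_N by simp
  finally show ?thesis by simp
qed

lemma card_V_ge: "card V \<ge> 4"
proof -
  obtain v where v: "v \<in> V" using nonempty by blast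
  have "card (insert v (N v)) = 4" using card_N[OF v] N_irrefl[of v] by simp
  moreover have "insert v (N v) \<subseteq> V" using v N_subset by auto
  ultimately show ?thesis using card_mono[OF fin] by metis
qed

lemma sum_N_swap: "(\<Sum>v\<in>V. \<Sum>w\<in>N v. f v w) = (\<Sum>v\<in>V. \<Sum>w\<in>N v. f w v)"
proof -
  have "(\<Sum>v\<in>V. \<Sum>w\<in>N v. f v w) = (\<Sum>v\<in>V. \<Sum>w | w \<in> V \<and> w \<in> N v. f v w)"
    using N_subset by (intro sum.cong) auto
  also have "\<dots> = (\<Sum>w\<in>V. \<Sum>v | v \<in> V \<and> w \<in> N v. f v w)"
    by (rule sum.swap_restrict[OF fin fin])
  also have "\<dots> = (\<Sum>w\<in>V. \<Sum>v\<in>N w. f v w)"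
    using N_subset N_sym by (intro sum.cong) auto
  finally show ?thesis .
qed

text \<open>The gap condition applied to \<open>y\<close> minus its mean.\<close>

lemma test_vector:
  fixes y :: "'a \<Rightarrow> real"
  assumes ab: "a \<in> V" "b \<in> V" "y a \<noteq> y b"
  shows "((\<Sum>v\<in>V. y v * (\<Sum>w\<in>N v. y w)) - (\<Sum>v\<in>V. (y v)\<^sup>2)) * card V < 2 * (\<Sum>v\<in>V. y v)\<^sup>2"
proof -
  define n where "n = real (card V)"
  define s where "s = (\<Sum>v\<in>V. y v)"
  define m where "m = s / n"
  have n: "n > 0" using card_V_ge by (simp add: n_def)
  have ms: "m * n = s" using n by (simp add: m_def)
  \<comment> \<open>Two different values cannot both equal the mean, so the centred vector is
    nonzero.\<close>
  have "y a \<noteq> m \<or> y b \<noteq> m" using ab by auto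
  then obtain u where u: "u \<in> V" "y u - m \<noteq> 0" using ab by auto
  have "(\<Sum>v\<in>V. y v - m) = 0"
    using ms by (simp add: sum_subtractf s_def n_def mult.commute)
  from gap[OF this u] have "(\<Sum>v\<in>V. (y v - m) * (\<Sum>w\<in>N v. y w - m)) < (\<Sum>v\<in>V. (y v - m)\<^sup>2)"
    by (simp add: N_def)
  also have "(\<Sum>v\<in>V. (y v - m) * (\<Sum>w\<in>N v. y w - m)) = (\<Sum>v\<in>V. (y v - m) * ((\<Sum>w\<in>N v. y w) - 3 * m))"
    by (intro sum.cong) (auto simp: sum_subtractf card_N)
  also have "\<dots> = (\<Sum>v\<in>V. y v * (\<Sum>w\<in>N v. y w) - 3 * m * y v - m * (\<Sum>w\<in>N v. y w) + 3 * m\<^sup>2)"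
    by (intro sum.cong) (auto simp: algebra_simps power2_eq_square)
  also have "\<dots> = (\<Sum>v\<in>V. y v * (\<Sum>w\<in>N v. y w)) - 3 * m * s - m * (\<Sum>v\<in>V. \<Sum>w\<in>N v. y w) + 3 * m\<^sup>2 * n"
    unfolding sum.distrib sum_subtractf sum_distrib_left[symmetric] by (simp add: s_def n_def)
  \<comment> \<open>Each \<open>y v\<close> is counted once per neighbour, hence three
    times.\<close>
  also have "(\<Sum>v\<in>V. \<Sum>w\<in>N v. y w) = (\<Sum>v\<in>V. \<Sum>w\<in>N v. y v)" by (rule sum_N_swap)
  also have "\<dots> = 3 * s"
    by (simp add: s_def sum_distrib_left card_N)
  also have "(\<Sum>v\<in>V. (y v - m)\<^sup>2) = (\<Sum>v\<in>V. (y v)\<^sup>2 - 2 * m * y v + m\<^sup>2)"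
    by (intro sum.cong) (auto simp: power2_diff)
  also have "\<dots> = (\<Sum>v\<in>V. (y v)\<^sup>2) - 2 * m * s + m\<^sup>2 * n"
    unfolding sum.distrib sum_subtractf sum_distrib_left[symmetric] by (simp add: s_def n_def)
  finally have "(\<Sum>v\<in>V. y v * (\<Sum>w\<in>N v. y w)) - (\<Sum>v\<in>V. (y v)\<^sup>2) < 4 * (m * s) - 2 * (m\<^sup>2 * n)"
    by (simp add: algebra_simps)
  also have "m\<^sup>2 * n = m * s" using ms by (simp add: power2_eq_square)
  finally have "(\<Sum>v\<in>V. y v * (\<Sum>w\<in>N v. y w)) - (\<Sum>v\<in>V. (y v)\<^sup>2) < 2 * m * s"
    by simp
  then have "((\<Sum>v\<in>V. y v * (\<Sum>w\<in>N v. y w)) - (\<Sum>v\<in>V. (y v)\<^sup>2)) * n < 2 * m * s * n"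
    using n by simp
  also have "2 * m * s * n = 2 * s\<^sup>2" using ms by (simp add: power2_eq_square)
  finally show ?thesis by (simp add: n_def s_def)
qed

section \<open>Bounds on the order from explicit test vectors\<close>

lemma card_V_less: "card V < 10"
proof -
  obtain u where u: "u \<in> V" using nonempty by blast
  \<comment> \<open>The sum is 5 and the squared norm 7. The adjacency form is at least 12: the
    centre gives \<open>2 * 3\<close>, each of its three neighbours at least 2, and edges between
    neighbours only add to this. So \<open>test_vector\<close> yields 5 times the order below
    50.\<close>
  define y :: "'a \<Rightarrow> real" where "y v = (if v = u then 2 else if v \<in> N u then 1 else 0)" for v
  let ?S = "insert u (N u)"
  have S: "?S \<subseteq> V" using u N_subset by auto
  have y0: "y v = 0" if "v \<notin> ?S" for v using that by (simp add: y_def)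
  have yu: "y u = 2" by (simp add: y_def)
  have yN: "y v = 1" if "v \<in> N u" for v using that N_irrefl by (auto simp: y_def)
  have sumV: "(\<Sum>v\<in>V. f v) = f u + (\<Sum>v\<in>N u. f v)" if "\<And>v. y v = 0 \<Longrightarrow> f v = 0" for f :: "'a \<Rightarrow> real"
  proof -
    have "(\<Sum>v\<in>V. f v) = (\<Sum>v\<in>?S. f v)"
      using S y0 that by (intro sum.mono_neutral_right[OF fin]) auto
    then show ?thesis using N_irrefl by simp
  qed
  have ge: "(\<Sum>w\<in>N v. y w) \<ge> 2" if "v \<in> N u" for v
  proof -
    have "y u \<le> (\<Sum>w\<in>N v. y w)"
      using that N_sym by (intro member_le_sum) (auto simp: y_def)
    then show ?thesis by (simp add: yu)
  qed
  have "(\<Sum>v\<in>V. y v) = 5" "(\<Sum>v\<in>V. (y v)\<^sup>2) = 7"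
    by (subst sumV; simp add: yu yN card_N[OF u])+
  moreover have "(\<Sum>v\<in>V. y v * (\<Sum>w\<in>N v. y w)) \<ge> 12"
  proof -
    have "(\<Sum>v\<in>N u. 2) \<le> (\<Sum>v\<in>N u. y v * (\<Sum>w\<in>N v. y w))"
      using ge yN by (intro sum_mono) auto
    then show ?thesis
      by (subst sumV) (simp_all add: yu yN card_N[OF u])
  qed
  moreover obtain b where "b \<in> N u" using card_N[OF u] by fastforce
  then have "((\<Sum>v\<in>V. y v * (\<Sum>w\<in>N v. y w)) - (\<Sum>v\<in>V. (y v)\<^sup>2)) * card V < 2 * (\<Sum>v\<in>V. y v)\<^sup>2"
    using N_subset u yu yN by (intro test_vector[of u b]) auto
  ultimately have "(12 - 7) * real (card V) < 50"
    using mult_right_mono[of "12 - 7" "(\<Sum>v\<in>V. y v * (\<Sum>w\<in>N v. y w)) - (\<Sum>v\<in>V. (y v)\<^sup>2)" "real (card V)"]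
    by simp
  then show ?thesis by simp
qed

text \<open>The test vector is the indicator of \<open>S\<close>, nonconstant because
  \<open>S\<close> is nonempty and proper. With \<open>k = card S\<close>, its sum and squared norm
  are \<open>k\<close>, and its adjacency form counts ordered adjacent pairs inside
  \<open>S\<close>, at least \<open>2 * k\<close>. This leaves
  \<open>k * card V < 2 * k\<^sup>2\<close>. Vertex sets of short cycles are the intended
  \<open>S\<close>.\<close>

lemma dense_subset:
  assumes S: "S \<subseteq> V" "S \<noteq> {}" "S \<noteq> V" and deg: "\<And>v. v \<in> S \<Longrightarrow> card (N v \<inter> S) \<ge> 2"
  shows "card V < 2 * card S"
proof -
  define y :: "'a \<Rightarrow> real" where "y v = of_bool (v \<in> S)" for v
  define k where "k = real (card S)"
  have finS: "finite S" using S fin finite_subset by blast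
  have inS: "(\<Sum>v\<in>A. y v) = card (A \<inter> S)" if "finite A" for A
    using that by (simp add: y_def sum.If_cases of_bool_def)
  have "(\<Sum>v\<in>V. y v * (\<Sum>w\<in>N v. y w)) = (\<Sum>v\<in>S. card (N v \<inter> S))"
  proof -
    have "(\<Sum>v\<in>V. y v * (\<Sum>w\<in>N v. y w)) = (\<Sum>v\<in>S. y v * (\<Sum>w\<in>N v. y w))"
      using S by (intro sum.mono_neutral_right[OF fin]) (auto simp: y_def)
    also have "\<dots> = (\<Sum>v\<in>S. card (N v \<inter> S))"
      unfolding of_nat_sum by (intro sum.cong) (auto simp: inS y_def[of v for v])
    finally show ?thesis .
  qed
  also have "real (\<Sum>v\<in>S. card (N v \<inter> S)) \<ge> real (\<Sum>v\<in>S. 2)"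
    using deg by (intro of_nat_mono sum_mono) auto
  finally have Q: "(\<Sum>v\<in>V. y v * (\<Sum>w\<in>N v. y w)) \<ge> 2 * k" by (simp add: k_def mult.commute)
  have s: "(\<Sum>v\<in>V. y v) = k" using inS[OF fin] S by (simp add: k_def Int_absorb1)
  have "(\<Sum>v\<in>V. (y v)\<^sup>2) = (\<Sum>v\<in>V. y v)" by (intro sum.cong) (auto simp: y_def)
  then have s2: "(\<Sum>v\<in>V. (y v)\<^sup>2) = k" using s by simp
  obtain a b where "a \<in> S" "b \<in> V" "b \<notin> S" using S by blast
  then have "((\<Sum>v\<in>V. y v * (\<Sum>w\<in>N v. y w)) - (\<Sum>v\<in>V. (y v)\<^sup>2)) * card V < 2 * (\<Sum>v\<in>V. y v)\<^sup>2"
    using S by (intro test_vector[of a b]) (auto simp: y_def)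
  then have "((\<Sum>v\<in>V. y v * (\<Sum>w\<in>N v. y w)) - k) * card V < 2 * k\<^sup>2" using s s2 by simp
  moreover have "k * card V \<le> ((\<Sum>v\<in>V. y v * (\<Sum>w\<in>N v. y w)) - k) * card V"
    using Q by (intro mult_right_mono) auto
  ultimately have "k * card V < k * (2 * k)" by (simp add: power2_eq_square)
  moreover have "k > 0" using S finS by (simp add: k_def card_gt_0_iff)
  ultimately have "card V < 2 * k" by simp
  then show ?thesis by (simp add: k_def)
qed

section \<open>Exclusion of short cycles and of order 8\<close>

lemma no_triangle:
  assumes "card V \<ge> 6" "b \<in> N a"
  shows "N a \<inter> N b = {}"
proof (rule ccontr)
  assume "N a \<inter> N b \<noteq> {}"
  then obtain c where c: "c \<in> N a" "c \<in> N b" by blast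
  let ?S = "{a, b, c}"
  have adj: "a \<in> N b" "a \<in> N c" "b \<in> N c" using c assms N_sym by auto
  then have ne: "a \<noteq> b" "a \<noteq> c" "b \<noteq> c" using N_irrefl by auto
  have S: "?S \<subseteq> V" using N_subset adj c by blast
  have k: "card ?S = 3" using ne by simp
  have "card V < 2 * card ?S"
  proof (rule dense_subset[OF S])
    show "?S \<noteq> V" using k assms(1) by auto
    fix v assume "v \<in> ?S"
    then have "\<exists>x y. {x, y} \<subseteq> N v \<inter> ?S \<and> x \<noteq> y"
      using c assms(2) adj ne by auto
    then obtain x y where xy: "{x, y} \<subseteq> N v \<inter> ?S" "x \<noteq> y" by blast
    then show "card (N v \<inter> ?S) \<ge> 2"
      using card_mono[OF _ xy(1)] by simp
  qed simp
  then show False using k assms(1) by simp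
qed

text \<open>A second common neighbour \<open>d\<close> would close the cycle \<open>a\<close>,
  \<open>b\<close>, \<open>d\<close>, \<open>c\<close>. Its diagonals may or may not be edges, since
  \<open>dense_subset\<close> asks only for two neighbours inside the set.\<close>

lemma no_quadrangle:
  assumes "card V \<ge> 8" "b \<in> N a" "c \<in> N a" "b \<noteq> c"
  shows "N b \<inter> N c = {a}"
proof (rule ccontr)
  have "a \<in> N b \<inter> N c" using assms N_sym by auto
  moreover assume "N b \<inter> N c \<noteq> {a}"
  ultimately obtain d where d: "d \<in> N b" "d \<in> N c" "d \<noteq> a" by blast
  let ?S = "{a, b, c, d}"
  have adj: "a \<in> N b" "a \<in> N c" "b \<in> N d" "c \<in> N d" using d assms N_sym by auto
  then have ne: "a \<noteq> b" "a \<noteq> c" "b \<noteq> d" "c \<noteq> d" using N_irrefl by auto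
  have S: "?S \<subseteq> V" using N_subset adj d assms by blast
  have k: "card ?S = 4" using ne d(3) assms(4) by auto
  have "card V < 2 * card ?S"
  proof (rule dense_subset[OF S])
    show "?S \<noteq> V" using k assms(1) by auto
    fix v assume "v \<in> ?S"
    then have "\<exists>x y. {x, y} \<subseteq> N v \<inter> ?S \<and> x \<noteq> y"
      using d assms(2-4) adj ne by auto
    then obtain x y where xy: "{x, y} \<subseteq> N v \<inter> ?S" "x \<noteq> y" by blast
    then show "card (N v \<inter> ?S) \<ge> 2"
      using card_mono[OF _ xy(1)] by simp
  qed simp
  then show False using k assms(1) by simp
qed

lemma card_V_ne_8: "card V \<noteq> 8"
proof
  assume 8: "card V = 8"
  obtain u where u: "u \<in> V" using nonempty by blast
  obtain b c d where bcd: "N u = {b, c, d}" "b \<noteq> c" "b \<noteq> d" "c \<noteq> d"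
    using card_N[OF u] by (auto simp: card_3_iff)
  \<comment> \<open>The two neighbours of \<open>v\<close> other than the root \<open>u\<close>,
    when \<open>v\<close> is adjacent to \<open>u\<close>. Without quadrangles these pairs are
    disjoint for different \<open>v\<close>, and without triangles they avoid \<open>N u\<close>,
    which gives \<open>1 + 3 + 6\<close> vertices.\<close>
  define M where "M v = N v - {u}" for v
  have "card (M v) = 2" if "v \<in> N u" for v
    using that N_sym[of v u] card_N[of v] N_subset[of u] by (auto simp: M_def)
  then have card_M: "card (M b) = 2" "card (M c) = 2" "card (M d) = 2" using bcd by auto
  have disj: "M b \<inter> M c = {}" "M b \<inter> M d = {}" "M c \<inter> M d = {}"
    using no_quadrangle[of b u c] no_quadrangle[of b u d] no_quadrangle[of c u d] 8 bcd
    unfolding M_def by auto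
  have finM: "finite (M v)" for v by (simp add: M_def)
  have "card (M b \<union> M c \<union> M d) = 6"
    using card_M disj finM by (simp add: card_Un_disjoint Int_Un_distrib2)
  moreover have "(M b \<union> M c \<union> M d) \<inter> insert u (N u) = {}"
    using no_triangle[of _ u] 8 bcd(1) unfolding M_def by auto
  moreover have "card (insert u (N u)) = 4" using card_N[OF u] N_irrefl[of u] by simp
  ultimately have "card ((M b \<union> M c \<union> M d) \<union> insert u (N u)) = 10"
    using finM by (subst card_Un_disjoint) auto
  moreover have "(M b \<union> M c \<union> M d) \<union> insert u (N u) \<subseteq> V"
    using N_subset u unfolding M_def by blast
  ultimately have "10 \<le> card V" using card_mono[OF fin] by metis
  then show False using 8 by simp
qed

text \<open>Parity and the bounds leave the orders 4 and 6. At order 4 each neighbourhood must be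
  everything else. At order 6 the classes are \<open>N u\<close> and its complement, both of size 3:
  without triangles the neighbourhood of any \<open>b\<close> in \<open>N u\<close> lies in the
  complement, hence fills it.\<close>

lemma complete_or_bipartite:
  "(card V = 4 \<and> (\<forall>v\<in>V. \<forall>w\<in>V. v \<noteq> w \<longrightarrow> E v w)) \<or>
   (\<exists>A B. A \<inter> B = {} \<and> card A = 3 \<and> card B = 3 \<and> (\<forall>a\<in>A. \<forall>b\<in>B. E a b))"
proof -
  obtain k where k: "card V = 2 * k" using even_card_V by blast
  then have "k = 2 \<or> k = 3" using card_V_ge card_V_less card_V_ne_8 by presburger
  then show ?thesis
  proof
    assume "k = 2"
    then have 4: "card V = 4" using k by simp
    have "E v w" if "v \<in> V" "w \<in> V" "v \<noteq> w" for v w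
    proof -
      have "N v = V - {v}"
        using N_subset N_irrefl fin 4 card_N that by (intro card_subset_eq) auto
      then show ?thesis using that by (auto simp: N_def)
    qed
    then show ?thesis using 4 by blast
  next
    assume "k = 3"
    then have 6: "card V = 6" using k by simp
    obtain u where u: "u \<in> V" using nonempty by blast
    let ?A = "V - N u"
    have A: "card ?A = 3" using 6 card_N[OF u] N_subset by (simp add: card_Diff_subset)
    have "E a b" if a: "a \<in> ?A" and b: "b \<in> N u" for a b
    proof -
      have "N b \<subseteq> ?A" using no_triangle[OF _ b] 6 N_subset by auto
      then have "N b = ?A" using A card_N N_subset b fin by (intro card_subset_eq) auto
      then show ?thesis using a N_sym by (auto simp: N_def)
    qed
    then show ?thesis using A card_N[OF u] by blast
  qed
qed

end

section \<open>Nonplanarity of the complete bipartite graph\<close>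

text \<open>By the Jordan curve theorem the inside and the outside are connected, open, disjoint,
  and both have the whole curve as frontier. \<open>D\<close> is one that does not contain
  \<open>q\<close>; if \<open>q\<close> is on the curve, the inside is taken.\<close>

lemma simple_closed_curve_other_side:
  fixes c :: "real \<Rightarrow> complex"
  assumes "simple_path c" "pathfinish c = pathstart c"
  obtains D where "D \<noteq> {}" "Topological_Spaces.connected D" "D \<subseteq> - path_image c" "path_image c \<subseteq> closure D"
    "\<And>y. y \<in> D \<Longrightarrow> \<not> connected_component (- path_image c) q y"
proof -
  let ?C = "path_image c"
  note J = Jordan_inside_outside[OF assms]
  have sep: "\<not> connected_component (- ?C) q y"
    if "open A" "open B" "A \<inter> B = {}" "A \<union> B = - ?C" "q \<notin> A" "y \<in> A" for A B y
  proof
    assume "connected_component (- ?C) q y"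
    then obtain T where "Topological_Spaces.connected T" "T \<subseteq> - ?C" "q \<in> T" "y \<in> T"
      unfolding connected_component_def by blast
    then show False
      using connectedD[of T A B] that by blast
  qed
  have cl: "?C \<subseteq> closure A" if "frontier A = ?C" for A
    using that by (auto simp: frontier_def)
  show ?thesis
  proof (cases "q \<in> inside ?C")
    case True
    then have q: "q \<notin> outside ?C" using J by blast
    show ?thesis
    proof (rule that)
      show "\<not> connected_component (- ?C) q y" if "y \<in> outside ?C" for y
        using J that q by (intro sep[of "outside ?C" "inside ?C"]) blast+
      show "outside ?C \<subseteq> - ?C" using J by blast
    qed (simp_all add: J cl)
  next
    case q: False
    show ?thesis
    proof (rule that)
      show "\<not> connected_component (- ?C) q y" if "y \<in> inside ?C" for y
        using J that q by (intro sep[of "inside ?C" "outside ?C"]) blast+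
      show "inside ?C \<subseteq> - ?C" using J by blast
    qed (simp_all add: J cl)
  qed
qed

text \<open>
  Take the side \<open>D\<close> of \<open>c1 \<union> c2\<close> not containing \<open>q\<close>. It is disjoint from \<open>c3\<close>, and its closure contains
  \<open>z1\<close> and \<open>z2\<close>; hence neither \<open>c2 \<union> c3\<close> nor \<open>c1 \<union> c3\<close> separates \<open>q\<close> from \<open>D\<close>. As these two sets
  intersect in the connected set \<open>c3\<close>, Janiszewski's theorem shows that their union, which contains
  \<open>c1 \<union> c2\<close>, does not separate \<open>q\<close> from \<open>D\<close> either.
\<close>

lemma theta_curve_no_common_face:
  fixes c1 c2 c3 :: "real \<Rightarrow> complex"
  assumes arcs: "arc c1" "arc c2" "arc c3"
    and start: "pathstart c1 = a" "pathstart c2 = a" "pathstart c3 = a"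
    and finish: "pathfinish c1 = b" "pathfinish c2 = b" "pathfinish c3 = b"
    and int: "path_image c1 \<inter> path_image c2 \<subseteq> {a, b}" "path_image c1 \<inter> path_image c3 \<subseteq> {a, b}"
      "path_image c2 \<inter> path_image c3 \<subseteq> {a, b}"
    and z: "z1 \<in> path_image c1" "z2 \<in> path_image c2" "z3 \<in> path_image c3"
    and q1: "connected_component (- (path_image c2 \<union> path_image c3)) q z1"
    and q2: "connected_component (- (path_image c1 \<union> path_image c3)) q z2"
    and q3: "connected_component (- (path_image c1 \<union> path_image c2)) q z3"
  shows False
proof -
  define X Y Z where "X = path_image c1" and "Y = path_image c2" and "Z = path_image c3"
  note XYZ = X_def[symmetric] Y_def[symmetric] Z_def[symmetric]
  note int = int[unfolded XYZ] and z = z[unfolded XYZ] and q1 = q1[unfolded XYZ]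
    and q2 = q2[unfolded XYZ] and q3 = q3[unfolded XYZ]
  have ab: "a \<in> X" "b \<in> X" "a \<in> Y" "b \<in> Y" "a \<in> Z" "b \<in> Z"
    using pathstart_in_path_image pathfinish_in_path_image start finish
    unfolding X_def Y_def Z_def by metis+
  have closed: "closed X" "closed Y" "closed Z" and compact: "compact X"  "compact Z"
    using arcs by (auto simp: X_def Y_def Z_def closed_arc_image compact_arc_image)
  have "simple_path (c1 +++ reversepath c2)"
    using arcs start finish int by (intro simple_path_join_loop) (auto simp: arc_reversepath XYZ)
  moreover have "path_image (c1 +++ reversepath c2) = X \<union> Y"
    using start finish by (simp add: path_image_join X_def Y_def)
  ultimately obtain D where D: "D \<noteq> {}" "Topological_Spaces.connected D" "D \<subseteq> - (X \<union> Y)" "X \<union> Y \<subseteq> closure D"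
    and sep: "\<And>y. y \<in> D \<Longrightarrow> \<not> connected_component (- (X \<union> Y)) q y"
    using simple_closed_curve_other_side[of "c1 +++ reversepath c2" q] start finish by auto
  \<comment> \<open>Without its end points the third arc is connected, avoids
    \<open>X \<union> Y\<close> and contains \<open>z3\<close>, so all of it is on the side of
    \<open>q\<close>.\<close>
  have DZ: "D \<inter> Z = {}"
  proof (rule ccontr)
    assume "D \<inter> Z \<noteq> {}"
    then obtain y where y: "y \<in> D" "y \<in> Z" by blast
    have "Topological_Spaces.connected (Z - {a, b})"
      using connected_simple_path_endless[OF arc_imp_simple_path[OF arcs(3)]] start finish
      by (simp add: Z_def)
    moreover have "z3 \<notin> X \<union> Y" using connected_component_in[OF q3] by simp
    then have "z3 \<in> Z - {a, b}" "y \<in> Z - {a, b}" "Z - {a, b} \<subseteq> - (X \<union> Y)"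
      using z ab y D int by auto
    ultimately have "connected_component (- (X \<union> Y)) z3 y"
      unfolding connected_component_def by blast
    then show False using sep[OF y(1)] q3 connected_component_trans by metis
  qed
  obtain y where y: "y \<in> D" using D by blast
  \<comment> \<open>\<open>D\<close> is connected and misses \<open>S \<union> Z\<close>, and the
    open component of \<open>w\<close> meets \<open>D\<close> because \<open>w\<close> is in its
    closure. Used with \<open>S = X\<close>, \<open>w = z2\<close> and with \<open>S = Y\<close>,
    \<open>w = z1\<close>.\<close>
  have cc: "connected_component (- (S \<union> Z)) q y"
    if "S \<subseteq> X \<union> Y" "closed S" "w \<in> X \<union> Y" "connected_component (- (S \<union> Z)) q w" for S w
  proof -
    let ?U = "connected_component_set (- (S \<union> Z)) w"
    have "open ?U"
      using closed that by (intro open_connected_component open_Compl closed_Un)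
    moreover have "w \<in> ?U"
      using connected_component_in[OF that(4)] by (simp add: connected_component_refl)
    moreover have "w \<in> closure D" using D that by blast
    ultimately have "?U \<inter> D \<noteq> {}" using open_Int_closure_eq_empty[of ?U D] by blast
    then obtain d where d: "d \<in> D" "connected_component (- (S \<union> Z)) w d" by auto
    moreover have "connected_component (- (S \<union> Z)) d y"
      unfolding connected_component_def using D DZ d y that(1) by (intro exI[of _ D]) auto
    ultimately show ?thesis using that(4) connected_component_trans by metis
  qed
  have "(X \<union> Z) \<inter> (Y \<union> Z) = Z" using int ab by auto
  then have "Topological_Spaces.connected ((X \<union> Z) \<inter> (Y \<union> Z))"
    using arcs by (simp add: Z_def connected_arc_image)
  then have "connected_component (- ((X \<union> Z) \<union> (Y \<union> Z))) q y"
    using cc[OF _ _ _ q2] cc[OF _ _ _ q1] z closed compact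
    by (intro Janiszewski[of "X \<union> Z" "Y \<union> Z"] closed_Un compact_Un) blast+
  then have "connected_component (- (X \<union> Y)) q y"
    by (rule connected_component_of_subset) auto
  then show False using sep y by blast
qed

text \<open>The edges at \<open>a1\<close> and \<open>a2\<close> form a theta curve: three arcs from
  \<open>p a1\<close> to \<open>p a2\<close> through the points of \<open>b1\<close>,
  \<open>b2\<close>, \<open>b3\<close>. The edge from \<open>a3\<close> to each of these points
  avoids the other two arcs, so \<open>p a3\<close> is a point \<open>q\<close> forbidden by
  \<open>theta_curve_no_common_face\<close>.\<close>

lemma no_plane_drawing_K33:
  assumes draw: "plane_drawing G p \<gamma>" and dist: "distinct [a1, a2, a3, b1, b2, b3]"
    and edge: "\<And>u v. u \<in> {a1, a2, a3} \<Longrightarrow> v \<in> {b1, b2, b3} \<Longrightarrow> u \<rightarrow>\<^bsub>G\<^esub> v"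
  shows False
proof -
  let ?I = "\<lambda>u v. path_image (\<gamma> u v)"
  have arc: "arc (\<gamma> u v)" "pathstart (\<gamma> u v) = p u" "pathfinish (\<gamma> u v) = p v"
    if "u \<in> {a1, a2, a3}" "v \<in> {b1, b2, b3}" for u v
    using draw edge[OF that] unfolding plane_drawing_def by blast+
  have cross: "?I u v \<inter> ?I u' v' \<subseteq> p ` ({u, v} \<inter> {u', v'})"
    if "u \<in> {a1, a2, a3}" "v \<in> {b1, b2, b3}" "u' \<in> {a1, a2, a3}" "v' \<in> {b1, b2, b3}" "u \<noteq> u' \<or> v \<noteq> v'"
    for u v u' v'
  proof -
    have "{u, v} \<noteq> {u', v'}" using that dist by (auto simp: doubleton_eq_iff)
    then show ?thesis
      using draw edge[OF that(1,2)] edge[OF that(3,4)] unfolding plane_drawing_def by blast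
  qed
  \<comment> \<open>The arc of the theta curve through \<open>p v\<close>.\<close>
  define c where "c v = \<gamma> a1 v +++ reversepath (\<gamma> a2 v)" for v
  have img: "path_image (c v) = ?I a1 v \<union> ?I a2 v" if "v \<in> {b1, b2, b3}" for v
    unfolding c_def using arc[of a1 v] arc[of a2 v] that by (subst path_image_join) auto
  have ends: "pathstart (c v) = p a1" "pathfinish (c v) = p a2" if "v \<in> {b1, b2, b3}" for v
    unfolding c_def using arc that by auto
  have c: "arc (c v)" if "v \<in> {b1, b2, b3}" for v
  proof -
    have "{a1, v} \<inter> {a2, v} = {v}" using dist that by auto
    then have "?I a1 v \<inter> ?I a2 v \<subseteq> {p v}" using cross[of a1 v a2 v] dist that by auto
    then show ?thesis
      unfolding c_def using arc that by (intro arc_join) (auto simp: arc_reversepath)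
  qed
  have int: "path_image (c v) \<inter> path_image (c w) \<subseteq> {p a1, p a2}"
    if "v \<in> {b1, b2, b3}" "w \<in> {b1, b2, b3}" "v \<noteq> w" for v w
  proof -
    have "?I u v \<inter> ?I u' w \<subseteq> {p a1, p a2}" if u: "u \<in> {a1, a2}" "u' \<in> {a1, a2}" for u u'
    proof -
      have "{u, v} \<inter> {u', w} \<subseteq> {a1, a2}" using that \<open>v \<noteq> w\<close> \<open>v \<in> _\<close> \<open>w \<in> _\<close> dist by auto
      then show ?thesis using cross[of u v u' w] u that \<open>v \<noteq> w\<close> \<open>v \<in> _\<close> \<open>w \<in> _\<close> by blast
    qed
    then show ?thesis unfolding img[OF that(1)] img[OF that(2)] by blast
  qed
  have pin: "p v \<in> path_image (c v)" if "v \<in> {b1, b2, b3}" for v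
    using img[OF that] arc[of a1 v] that pathfinish_in_path_image[of "\<gamma> a1 v"] by auto
  have acc: "connected_component (- (path_image (c v) \<union> path_image (c w))) (p a3) (p x)"
    if "v \<in> {b1, b2, b3}" "w \<in> {b1, b2, b3}" "x \<in> {b1, b2, b3}" "x \<noteq> v" "x \<noteq> w" for v w x
  proof -
    have "?I a3 x \<inter> ?I u y = {}" if "u \<in> {a1, a2}" "y \<in> {v, w}" for u y
    proof -
      have "{a3, x} \<inter> {u, y} = {}" "y \<in> {b1, b2, b3}"
        using that dist \<open>x \<noteq> v\<close> \<open>x \<noteq> w\<close> \<open>v \<in> _\<close> \<open>w \<in> _\<close> \<open>x \<in> _\<close> by auto
      then show ?thesis
        using cross[of a3 x u y] that dist \<open>x \<in> _\<close> by auto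
    qed
    then have "?I a3 x \<subseteq> - (path_image (c v) \<union> path_image (c w))"
      unfolding img[OF that(1)] img[OF that(2)] by blast
    moreover have "Topological_Spaces.connected (?I a3 x)" "p a3 \<in> ?I a3 x" "p x \<in> ?I a3 x"
      using arc[of a3 x] that(3) connected_arc_image pathstart_in_path_image[of "\<gamma> a3 x"]
        pathfinish_in_path_image[of "\<gamma> a3 x"] by auto
    ultimately show ?thesis unfolding connected_component_def by blast
  qed
  have b: "b1 \<in> {b1, b2, b3}" "b2 \<in> {b1, b2, b3}" "b3 \<in> {b1, b2, b3}" by auto
  have ne: "b1 \<noteq> b2" "b1 \<noteq> b3" "b2 \<noteq> b3" using dist by auto
  show False
    using theta_curve_no_common_face[OF c[OF b(1)] c[OF b(2)] c[OF b(3)]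
        ends(1)[OF b(1)] ends(1)[OF b(2)] ends(1)[OF b(3)]
        ends(2)[OF b(1)] ends(2)[OF b(2)] ends(2)[OF b(3)]
        int[OF b(1,2) ne(1)] int[OF b(1,3) ne(2)] int[OF b(2,3) ne(3)]
        pin[OF b(1)] pin[OF b(2)] pin[OF b(3)]
        acc[OF b(2,3,1) ne(1,2)] acc[OF b(1,3,2) ne(1)[symmetric] ne(3)]
        acc[OF b(1,2,3) ne(2,3)[symmetric]]] .
qed

section \<open>The Laplacian quadratic form\<close>

text \<open>Degrees count arcs, while the combinatorial part counts neighbours; they agree because
  \<open>head\<close> is injective on the arcs leaving \<open>v\<close> when there are no parallel
  arcs.\<close>

lemma (in graph) card_dominated_eq_out_degree: "card {w. v \<rightarrow>\<^bsub>G\<^esub> w} = out_degree G v"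
proof -
  have "inj_on (head G) (out_arcs G v)"
    using no_multi_arcs by (auto simp: inj_on_def arc_to_ends_def)
  moreover have "head G ` out_arcs G v = {w. v \<rightarrow>\<^bsub>G\<^esub> w}"
    by (auto simp: arcs_ends_def arc_to_ends_def)
  ultimately show ?thesis
    unfolding out_degree_def by (metis card_image)
qed

text \<open>The Laplacian sends the constant vector to 0, so positivity of the second smallest
  eigenvalue lets that vector serve as \<open>u\<close> in
  \<open>rayleigh_second_smallest_eigenvalue\<close>.\<close>

lemma (in graph) algebraic_connectivity_le_quadratic_form:
  fixes y :: "'a \<Rightarrow> real"
  assumes n: "card (verts G) \<ge> 2" and pos: "algebraic_connectivity G > 0"
    and y: "(\<Sum>v\<in>verts G. y v) = 0"
  shows "algebraic_connectivity G * (\<Sum>v\<in>verts G. (y v)\<^sup>2) \<le>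
    (\<Sum>v\<in>verts G. y v * (out_degree G v * y v - (\<Sum>w | v \<rightarrow>\<^bsub>G\<^esub> w. y w)))"
proof -
  obtain vs where vs: "distinct vs" "set vs = verts G"
    using finite_distinct_list[OF finite_verts] by blast
  define n where "n = length vs"
  have len: "n = card (verts G)" using vs distinct_card n_def by metis
  define A where "A = laplacian_mat G vs"
  have A: "A \<in> carrier_mat n n"
    by (auto simp: A_def laplacian_mat_def adjacency_mat_def degree_mat_def n_def)
  have Aij: "A $$ (i, j) = (if i = j then real (out_degree G (vs ! i)) else 0) -
      (if vs ! i \<rightarrow>\<^bsub>G\<^esub> vs ! j then 1 else 0)" if "i < n" "j < n" for i j
    using that by (simp add: A_def laplacian_mat_def adjacency_mat_def degree_mat_def n_def)
  have sym: "transpose_mat A = A"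
    using A Aij graph_symmetric by (intro eq_matI) auto
  have reindex: "(\<Sum>i\<in>{0..<n}. f (vs ! i)) = (\<Sum>v\<in>verts G. f v)" for f :: "'a \<Rightarrow> real"
  proof -
    have "bij_betw ((!) vs) {0..<n} (verts G)"
      using bij_betw_nth[OF vs(1), of "{..<n}" "verts G"] vs(2) by (simp add: n_def lessThan_atLeast0)
    then show ?thesis by (rule sum.reindex_bij_betw)
  qed
  \<comment> \<open>Functions on vertices become coordinate vectors along \<open>vs\<close>, so that
    scalar products turn into sums over the vertex set.\<close>
  define X where "X f = Matrix.vec n (\<lambda>i. f (vs ! i))" for f :: "'a \<Rightarrow> real"
  have X: "X f \<in> carrier_vec n" for f by (simp add: X_def)
  have XX: "X f \<bullet> X g = (\<Sum>v\<in>verts G. f v * g v)" for f g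
    using reindex[of "\<lambda>v. f v * g v"] by (simp add: X_def scalar_prod_def)
  have AX: "A *\<^sub>v X f = X (\<lambda>v. out_degree G v * f v - (\<Sum>w | v \<rightarrow>\<^bsub>G\<^esub> w. f w))" for f :: "'a \<Rightarrow> real"
  proof (rule eq_vecI)
    fix i assume "i < dim_vec (X (\<lambda>v. out_degree G v * f v - (\<Sum>w | v \<rightarrow>\<^bsub>G\<^esub> w. f w)))"
    then have i: "i < n" by (simp add: X_def)
    let ?v = "vs ! i"
    have "(A *\<^sub>v X f) $ i = (\<Sum>j\<in>{0..<n}. A $$ (i, j) * f (vs ! j))"
      using A i by (simp add: X_def scalar_prod_def)
    also have "\<dots> = (\<Sum>j\<in>{0..<n}. (if i = j then real (out_degree G ?v) * f (vs ! j) else 0) -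
        (if ?v \<rightarrow>\<^bsub>G\<^esub> vs ! j then f (vs ! j) else 0))"
      using i by (intro sum.cong) (auto simp: Aij algebra_simps)
    also have "\<dots> = real (out_degree G ?v) * f ?v - (\<Sum>w\<in>verts G. if ?v \<rightarrow>\<^bsub>G\<^esub> w then f w else 0)"
      using i by (simp add: sum_subtractf reindex[of "\<lambda>w. if ?v \<rightarrow>\<^bsub>G\<^esub> w then f w else 0"])
    also have "(\<Sum>w\<in>verts G. if ?v \<rightarrow>\<^bsub>G\<^esub> w then f w else 0) = (\<Sum>w | ?v \<rightarrow>\<^bsub>G\<^esub> w. f w)"
      by (intro sum.mono_neutral_cong_right) (auto dest: adj_in_verts)
    finally show "(A *\<^sub>v X f) $ i = X (\<lambda>v. out_degree G v * f v - (\<Sum>w | v \<rightarrow>\<^bsub>G\<^esub> w. f w)) $ i"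
      using i by (simp add: X_def)
  qed (use A in \<open>simp add: X_def\<close>)
  have ac: "algebraic_connectivity G = sorted_list_of_multiset (proots (char_poly A)) ! 1"
    unfolding algebraic_connectivity_def laplacian_eigenvalues_enum[OF vs] A_def ..
  have "A *\<^sub>v X (\<lambda>_. 1) = 0 \<cdot>\<^sub>v X (\<lambda>_. 1)"
    unfolding AX by (simp add: card_dominated_eq_out_degree) (simp add: X_def smult_vec_def vec_eq_iff)
  moreover have "X (\<lambda>_. 1) \<noteq> 0\<^sub>v n"
  proof
    assume "X (\<lambda>_. 1) = 0\<^sub>v n"
    then have "X (\<lambda>_. 1) $ 0 = 0" using n len by simp
    then show False using n len by (simp add: X_def)
  qed
  moreover have "X y \<bullet> X (\<lambda>_. 1) = 0" using y by (simp add: XX)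
  ultimately have "algebraic_connectivity G * (X y \<bullet> X y) \<le> X y \<bullet> (A *\<^sub>v X y)"
    using n len pos X by (intro rayleigh_second_smallest_eigenvalue[OF A sym _ ac]) auto
  then show ?thesis
    unfolding AX XX by (simp add: power2_eq_square)
qed

section \<open>Contradiction for a planar cubic graph with second eigenvalue above 2\<close>

theorem theorem5p3:
  fixes G :: "('a, 'b) pre_digraph"
  assumes "graph G"
    and "verts G \<noteq> {}"
    and "planar G"
    and "cubic G"
    and "\<not> complete_digraph 4 G"
  shows "algebraic_connectivity G \<le> 2"
proof (rule ccontr)
  interpret graph G by fact
  assume gap: "\<not> algebraic_connectivity G \<le> 2"
  have deg: "out_degree G v = 3" if "v \<in> verts G" for v
    using \<open>cubic G\<close> that by (simp add: cubic_def)
  obtain u where u: "u \<in> verts G" using \<open>verts G \<noteq> {}\<close> by blast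
  \<comment> \<open>Three neighbours ensure at least two vertices, so index 1 of the eigenvalue list
    exists.\<close>
  have "{w. u \<rightarrow>\<^bsub>G\<^esub> w} \<subseteq> verts G" using adj_in_verts by auto
  then have n: "card (verts G) \<ge> 2"
    using card_mono[OF finite_verts, of "{w. u \<rightarrow>\<^bsub>G\<^esub> w}"] deg[OF u]
    by (simp add: card_dominated_eq_out_degree)
  interpret C: cubic_relation_with_gap "verts G" "\<lambda>v w. v \<rightarrow>\<^bsub>G\<^esub> w"
  proof
    fix y :: "'a \<Rightarrow> real" and u
    assume y: "(\<Sum>v\<in>verts G. y v) = 0" and u: "u \<in> verts G" "y u \<noteq> 0"
    let ?Q = "\<Sum>v\<in>verts G. y v * (\<Sum>w | v \<rightarrow>\<^bsub>G\<^esub> w. y w)"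
    let ?R = "\<Sum>v\<in>verts G. (y v)\<^sup>2"
    have "?R > 0" by (rule sum_pos2[of _ u]) (use u in auto)
    \<comment> \<open>Degree 3 turns the Laplacian form into \<open>3 * ?R - ?Q\<close>, so
      \<open>2 * ?R < 3 * ?R - ?Q\<close>, which is the required \<open>gap\<close>.\<close>
    then have "2 * ?R < algebraic_connectivity G * ?R" using gap by simp
    also have "\<dots> \<le> (\<Sum>v\<in>verts G. y v * (out_degree G v * y v - (\<Sum>w | v \<rightarrow>\<^bsub>G\<^esub> w. y w)))"
      using n y gap by (intro algebraic_connectivity_le_quadratic_form) auto
    also have "\<dots> = (\<Sum>v\<in>verts G. 3 * (y v)\<^sup>2 - y v * (\<Sum>w | v \<rightarrow>\<^bsub>G\<^esub> w. y w))"
      by (intro sum.cong) (auto simp: deg algebra_simps power2_eq_square)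
    also have "\<dots> = 3 * ?R - ?Q" by (simp add: sum_subtractf sum_distrib_left)
    finally show "?Q < ?R" by simp
  next
    show "v \<in> verts G" "w \<rightarrow>\<^bsub>G\<^esub> v" if "v \<rightarrow>\<^bsub>G\<^esub> w" for v w
      using that adj_in_verts graph_symmetric by blast+
    show "\<not> v \<rightarrow>\<^bsub>G\<^esub> v" for v using adj_not_same by blast
    show "card {w. v \<rightarrow>\<^bsub>G\<^esub> w} = 3" if "v \<in> verts G" for v
      using deg[OF that] by (simp add: card_dominated_eq_out_degree)
  qed (use assms in simp_all)
  \<comment> \<open>Order 4 gives the excluded complete graph; otherwise nine edges form a complete
    bipartite graph, which contradicts planarity.\<close>
  from C.complete_or_bipartite show False
  proof (elim disjE exE conjE)
    assume 4: "card (verts G) = 4" "\<forall>v\<in>verts G. \<forall>w\<in>verts G. v \<noteq> w \<longrightarrow> v \<rightarrow>\<^bsub>G\<^esub> w"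
    have "v \<rightarrow>\<^bsub>G\<^esub> w \<longleftrightarrow> v \<in> verts G \<and> w \<in> verts G \<and> v \<noteq> w" for v w
      using 4(2) adj_in_verts[of v w] adj_not_same[of v] by metis
    then have "arcs_ends G = {(u, v). (u, v) \<in> verts G \<times> verts G \<and> u \<noteq> v}"
      by (simp add: set_eq_iff)
    then have "complete_digraph 4 G"
      unfolding complete_digraph_def using \<open>graph G\<close> 4(1) by simp
    then show False using assms by blast
  next
    fix A B
    assume AB: "A \<inter> B = {}" "card A = 3" "card B = 3" "\<forall>a\<in>A. \<forall>b\<in>B. a \<rightarrow>\<^bsub>G\<^esub> b"
    obtain a1 a2 a3 where A: "A = {a1, a2, a3}" "a1 \<noteq> a2" "a1 \<noteq> a3" "a2 \<noteq> a3"
      using AB(2) by (auto simp: card_3_iff)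
    obtain b1 b2 b3 where B: "B = {b1, b2, b3}" "b1 \<noteq> b2" "b1 \<noteq> b3" "b2 \<noteq> b3"
      using AB(3) by (auto simp: card_3_iff)
    obtain p \<gamma> where "plane_drawing G p \<gamma>" using \<open>planar G\<close> unfolding planar_def by blast
    moreover have "distinct [a1, a2, a3, b1, b2, b3]" using A B AB(1) by auto
    ultimately show False
      using no_plane_drawing_K33[of G p \<gamma> a1 a2 a3 b1 b2 b3] AB(4) A(1) B(1) by blast
  qed
qed

end
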